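(* In the ring of formal power series in the variable $q$, $$\sum_{m,r\ge 0} \frac{q^{2m^2+2mr+r^2}}{(q^2;q^2)_m\,(q;q)_r} = \prod_{n=1}^\infty \frac{(1-q^{6n-3})^2(1-q^{6n})}{1-q^n},$$ where the sum is over all pairs of non-negative integers $(m,r)$.
   Context: $q$ is a formal variable. For an integer $n\ge 0$, $(a;q)_n=(1-a)(1-aq)(1-aq^2)\cdots(1-aq^{n-1})$, with $(a;q)_0=1$. Replacing the base $q$ by $q^k$ gives $(a;q^k)_n=\prod_{j=0}^{n-1}(1-aq^{kj})$; thus $(q^2;q^2)_m=\prod_{j=1}^{m}(1-q^{2j})$ and $(q;q)_r=\prod_{j=1}^{r}(1-q^{j})$. Infinite sums and products are understood in the usual topology of formal power series, and reciprocals are those of power series with constant term $1$. *)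

theory Defs
  imports "HOL-Analysis.Analysis"
begin

text \<open>The second argument is the base: \<open>qpoch a (q ^ k) n\<close> is \<open>(a; q\<^sup>k)\<^sub>n\<close>.\<close>

definition qpoch :: "'a::comm_ring_1 \<Rightarrow> 'a \<Rightarrow> nat \<Rightarrow> 'a" where
  "qpoch a q n = (\<Prod>j<n. 1 - a * q ^ j)"

end

theory Submission
  imports Defs
begin

text \<open>
  With \<open>N = m + r\<close> the summand is \<open>q^(N^2 + m^2) / ((q\<^sup>2;q\<^sup>2)\<^sub>m (q;q)\<^sub>N\<^sub>-\<^sub>m)\<close>. Gauss' identity says that
  \<open>\<beta>\<^sub>m = 1 / (q\<^sup>2;q\<^sup>2)\<^sub>m\<close> forms a Bailey pair (relative to 1) with the coefficients \<open>(-1)^n q^(n^2)\<close>,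
  \<open>n \<in> \<int>\<close>. Two applications of Bailey's lemma, the second one truncated at \<open>N \<le> L\<close>, give
  \<open>\<Sum> (-1)^n q^(3n^2) / ((q;q)\<^sub>L\<^sub>-\<^sub>n (q;q)\<^sub>L\<^sub>+\<^sub>n)\<close>. Multiplied by \<open>(q;q)\<^sub>L\<close> and read modulo \<open>q^(L + 1)\<close>,
  this is on one side the sum over \<open>m + r \<le> L\<close> and on the other side, by the finite Jacobi triple
  product in base \<open>q^6\<close>, the partial product up to \<open>L\<close>. Gauss' identity and the finite triple product are
  both proved by telescoping the difference of the two sides of a recurrence in the upper limit.
\<close>

section \<open>Reciprocals of finite q-Pochhammer symbols\<close>

definition qrec :: "'a::field fps \<Rightarrow> nat \<Rightarrow> 'a fps" where
  "qrec q n = inverse (qpoch q q n)"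

lemma qpoch_0 [simp]: "qpoch a q 0 = 1"
  by (simp add: qpoch_def)

lemma qpoch_Suc: "qpoch a q (Suc n) = qpoch a q n * (1 - a * q ^ n)"
  by (simp add: qpoch_def)

lemma fps_nth_0_prod: "fps_nth (\<Prod>i\<in>A. f i) 0 = (\<Prod>i\<in>A. fps_nth (f i) 0)"
  for f :: "'b \<Rightarrow> 'a::comm_ring_1 fps"
  by (induction A rule: infinite_finite_induct) auto

lemma fps_nth_0_qpoch:
  "fps_nth a 0 = 0 \<Longrightarrow> fps_nth (qpoch a q n) 0 = (1 :: 'a::field)"
  by (simp add: qpoch_def fps_nth_0_prod)

lemma qpoch_mult_qrec:
  "fps_nth q 0 = 0 \<Longrightarrow> qpoch q q n * qrec q n = 1"
  unfolding qrec_def using inverse_mult_eq_1'[of "qpoch q q n"] by (simp add: fps_nth_0_qpoch)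

lemma qrec_0 [simp]: "qrec q 0 = 1"
  by (simp add: qrec_def)

text \<open>Clears the denominator factor by going from the larger index to the smaller, so later
  recurrences involve only polynomial multiples of reciprocals and no quotients.\<close>

lemma qrec_eq_Suc:
  fixes q :: "'a::field fps"
  assumes "fps_nth q 0 = 0"
  shows "qrec q n = (1 - q ^ Suc n) * qrec q (Suc n)"
proof -
  have "qrec q n = qrec q n * (qpoch q q (Suc n) * qrec q (Suc n))"
    by (simp add: qpoch_mult_qrec[OF assms])
  also have "\<dots> = (qpoch q q n * qrec q n) * ((1 - q ^ Suc n) * qrec q (Suc n))"
    by (simp add: qpoch_Suc mult_ac)
  finally show ?thesis
    by (simp add: qpoch_mult_qrec[OF assms])
qed

lemma one_minus_power_neq_0:
  fixes q :: "'a::field fps"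
  assumes "fps_nth q 0 = 0" "0 < n"
  shows "1 - q ^ n \<noteq> 0"
proof
  assume "1 - q ^ n = 0"
  then have "fps_nth (1 - q ^ n) 0 = 0" by simp
  with assms show False by (simp add: fps_power_zeroth zero_power)
qed

section \<open>The q-Vandermonde sum and Bailey's lemma\<close>

text \<open>This evaluates the inner sum in Bailey's lemma. The induction keeps \<open>a\<close>
  arbitrary because the recurrence for the left side \<open>F\<close> raises it: (1 - q^(M+1))
  F(M+1, a) = F(M, a) + q^(M+1+a) F(M, a+1).\<close>

lemma qrec_vandermonde:
  fixes q :: "'a::field fps"
  assumes q0: "fps_nth q 0 = 0"
  shows "(\<Sum>j\<le>M. q ^ (j * (j + a)) * qrec q (M - j) * qrec q j * qrec q (j + a)) =
         qrec q M * qrec q (M + a)"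
proof (induction M arbitrary: a)
  case 0
  then show ?case by simp
next
  case (Suc M)
  let ?u = "qrec q"
  define F where "F = (\<lambda>M a. \<Sum>j\<le>M. q ^ (j * (j + a)) * ?u (M - j) * ?u j * ?u (j + a))"
  note u = qrec_eq_Suc[OF q0]
  \<comment> \<open>\<open>g\<close> and \<open>h\<close> split each summand by 1 - q^(M+1) = (1 -
    q^(M+1-j)) + q^(M+1-j) (1 - q^j). The first factor lowers \<open>M\<close>; the second cancels
    against \<open>qrec q j\<close> and shifts \<open>j\<close>.\<close>
  define g where "g = (\<lambda>j. q ^ (j * (j + a)) * (1 - q ^ (Suc M - j)) * ?u (Suc M - j) * ?u j * ?u (j + a))"
  define h where "h = (\<lambda>j. q ^ (j * (j + a)) * q ^ (Suc M - j) * ?u (Suc M - j) * (1 - q ^ j) * ?u j * ?u (j + a))"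
  have "(1 - q ^ Suc M) * F (Suc M) a = (\<Sum>j\<le>Suc M. g j + h j)"
    unfolding F_def sum_distrib_left
  proof (intro sum.cong refl)
    fix j assume "j \<in> {..Suc M}"
    then have "q ^ Suc M = q ^ (Suc M - j) * q ^ j"
      by (simp flip: power_add)
    then show "(1 - q ^ Suc M) * (q ^ (j * (j + a)) * ?u (Suc M - j) * ?u j * ?u (j + a)) = g j + h j"
      unfolding g_def h_def by (simp add: algebra_simps del: power_Suc)
  qed
  also have "\<dots> = (\<Sum>j\<le>Suc M. g j) + (\<Sum>j\<le>Suc M. h j)"
    by (rule sum.distrib)
  also have "(\<Sum>j\<le>Suc M. g j) = (\<Sum>j\<le>M. g j)"
    by (simp add: g_def)
  also have "\<dots> = F M a"
    unfolding F_def
  proof (intro sum.cong refl)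
    fix j assume "j \<in> {..M}"
    then have "Suc M - j = Suc (M - j)" by auto
    then show "g j = q ^ (j * (j + a)) * ?u (M - j) * ?u j * ?u (j + a)"
      unfolding g_def using u[of "M - j"] by (simp add: mult_ac)
  qed
  also have "(\<Sum>j\<le>Suc M. h j) = (\<Sum>j\<le>M. h (Suc j))"
    by (subst sum.atMost_Suc_shift) (simp add: h_def)
  also have "\<dots> = q ^ (Suc M + a) * F M (Suc a)"
    unfolding F_def sum_distrib_left
  proof (intro sum.cong refl)
    fix j assume "j \<in> {..M}"
    then have "Suc j * (Suc j + a) + (M - j) = (Suc M + a) + j * (j + Suc a)"
      by (simp add: algebra_simps)
    then have pow: "q ^ (Suc j * (Suc j + a)) * q ^ (M - j) = q ^ (Suc M + a) * q ^ (j * (j + Suc a))"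
      by (simp only: power_add [symmetric])
    have "h (Suc j) = (q ^ (Suc j * (Suc j + a)) * q ^ (M - j)) * ?u (M - j) *
        ((1 - q ^ Suc j) * ?u (Suc j)) * ?u (Suc j + a)"
      by (simp only: h_def diff_Suc_Suc mult_ac)
    also have "\<dots> = q ^ (Suc M + a) * (q ^ (j * (j + Suc a)) * ?u (M - j) * ?u j * ?u (j + Suc a))"
      by (simp only: pow u[of j, symmetric]) (simp add: mult_ac)
    finally show "h (Suc j) = q ^ (Suc M + a) *
        (q ^ (j * (j + Suc a)) * ?u (M - j) * ?u j * ?u (j + Suc a))" .
  qed
  finally have "(1 - q ^ Suc M) * F (Suc M) a = F M a + q ^ (Suc M + a) * F M (Suc a)" .
  also have "\<dots> = ?u M * ?u (M + a) + q ^ (Suc M + a) * (?u M * ?u (Suc M + a))"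
    unfolding F_def Suc.IH by simp
  also have "\<dots> = ?u M * ?u (Suc M + a)"
    by (simp only: u[of "M + a"] add_Suc) (simp add: algebra_simps)
  also have "\<dots> = (1 - q ^ Suc M) * (?u (Suc M) * ?u (Suc M + a))"
    by (subst u[of M]) (simp only: mult_ac)
  finally show ?case
    using one_minus_power_neq_0[OF q0, of "Suc M"] unfolding F_def mult_cancel_left by blast
qed

text \<open>After interchanging the sums and putting m = j + n, the exponent is n^2 + j (j + 2n), so
  the inner sum is q-Vandermonde with upper limit N - n and shift 2n. The right side has the shape
  of the inner sum on the left, with \<alpha> multiplied by q^(n^2), so the lemma can be
  iterated.\<close>

lemma bailey_lemma:
  fixes q :: "'a::field fps"
  assumes q0: "fps_nth q 0 = 0"
  shows "(\<Sum>m\<le>N. q ^ m\<^sup>2 * qrec q (N - m) * (\<Sum>n\<le>m. \<alpha> n * qrec q (m - n) * qrec q (m + n))) =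
         (\<Sum>n\<le>N. q ^ n\<^sup>2 * \<alpha> n * qrec q (N - n) * qrec q (N + n))"
proof -
  let ?u = "qrec q"
  define f where "f = (\<lambda>m n. q ^ m\<^sup>2 * ?u (N - m) * (\<alpha> n * ?u (m - n) * ?u (m + n)))"
  have "(\<Sum>m\<le>N. q ^ m\<^sup>2 * ?u (N - m) * (\<Sum>n\<le>m. \<alpha> n * ?u (m - n) * ?u (m + n))) =
        (\<Sum>m\<in>{..N}. \<Sum>n | n \<in> {..N} \<and> n \<le> m. f m n)"
    unfolding sum_distrib_left f_def by (intro sum.cong refl) auto
  also have "\<dots> = (\<Sum>n\<in>{..N}. \<Sum>m | m \<in> {..N} \<and> n \<le> m. f m n)"
    by (rule sum.swap_restrict) auto
  also have "\<dots> = (\<Sum>n\<in>{..N}. q ^ n\<^sup>2 * \<alpha> n * ?u (N - n) * ?u (N + n))"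
  proof (intro sum.cong refl)
    fix n assume n: "n \<in> {..N}"
    have "(\<Sum>m | m \<in> {..N} \<and> n \<le> m. f m n) = (\<Sum>j\<le>N - n. f (j + n) n)"
      by (rule sum.reindex_bij_witness[of _ "\<lambda>j. j + n" "\<lambda>m. m - n"]) (use n in auto)
    also have "\<dots> = (\<Sum>j\<le>N - n. q ^ n\<^sup>2 * \<alpha> n *
        (q ^ (j * (j + 2 * n)) * ?u (N - n - j) * ?u j * ?u (j + 2 * n)))"
    proof (intro sum.cong refl)
      fix j
      have "(j + n)\<^sup>2 = n\<^sup>2 + j * (j + 2 * n)"
        by (simp add: power2_eq_square algebra_simps)
      moreover have "N - (j + n) = N - n - j" "j + n - n = j" "j + n + n = j + 2 * n" by auto
      ultimately show "f (j + n) n = q ^ n\<^sup>2 * \<alpha> n *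
          (q ^ (j * (j + 2 * n)) * ?u (N - n - j) * ?u j * ?u (j + 2 * n))"
        by (simp only: f_def power_add mult_ac)
    qed
    also have "\<dots> = q ^ n\<^sup>2 * \<alpha> n * (?u (N - n) * ?u (N - n + 2 * n))"
      by (simp only: sum_distrib_left [symmetric] qrec_vandermonde[OF q0])
    also have "N - n + 2 * n = N + n" using n by simp
    finally show "(\<Sum>m | m \<in> {..N} \<and> n \<le> m. f m n) = q ^ n\<^sup>2 * \<alpha> n * ?u (N - n) * ?u (N + n)"
      by (simp add: mult_ac)
  qed
  finally show ?thesis .
qed

text \<open>The bilateral sums are symmetric in \<open>n\<close>; they are folded to sums over \<open>n \<ge> 0\<close> with these weights.\<close>

definition theta_sign :: "nat \<Rightarrow> 'a::comm_ring_1" where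
  "theta_sign n = (if n = 0 then 1 else 2 * (-1) ^ n)"

section \<open>Gauss' identity and the finite triple product\<close>

text \<open>Multiplication by (q;q)_(2m) turns the left side into an alternating sum of Gaussian
  binomials, with value (q;q^2)_m. The induction rests on the recurrence (1 - q^(2M+2)) S(M+1) =
  S(M).\<close>

lemma gauss_bailey_pair:
  fixes q :: "'a::field fps"
  assumes q0: "fps_nth q 0 = 0"
  shows "(\<Sum>n\<le>m. theta_sign n * q ^ n\<^sup>2 * qrec q (m - n) * qrec q (m + n)) = qrec (q\<^sup>2) m"
proof (induction m)
  case 0
  then show ?case by (simp add: theta_sign_def)
next
  case (Suc M)
  let ?u = "qrec q"
  note u = qrec_eq_Suc[OF q0]
  define S where "S = (\<lambda>m. \<Sum>n\<le>m. theta_sign n * q ^ n\<^sup>2 * ?u (m - n) * ?u (m + n))"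
  define w where "w = (\<lambda>n. theta_sign n * q ^ n\<^sup>2 * ?u (Suc M - n) * ?u (Suc M + n))"
  define w' where "w' = (\<lambda>n. theta_sign n * q ^ n\<^sup>2 * ?u (M - n) * ?u (M + n))"
  \<comment> \<open>the certificate comes from \<open>(-1)^n q^(n^2) (q^m - q^n) / ((q;q)\<^sub>m\<^sub>-\<^sub>n (q;q)\<^sub>m\<^sub>+\<^sub>n)\<close> being antisymmetric under \<open>n \<mapsto> -1 - n\<close>\<close>
  have partial: "(\<Sum>n\<le>j. w' n - (1 - q ^ (2 * Suc M)) * w n) =
      - 2 * (-1) ^ j * q ^ (Suc M + j\<^sup>2 + j) * ?u (M - j) * ?u (Suc M + j)" if "j \<le> M" for j
    using that
  proof (induction j)
    case 0
    have "?u M = (1 - q ^ Suc M) * ?u (Suc M)" by (rule u)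
    moreover have "q ^ (2 * Suc M) = q ^ Suc M * q ^ Suc M"
      by (simp only: power_add [symmetric]) (simp add: mult_2)
    ultimately show ?case
      by (simp add: w_def w'_def theta_sign_def del: power_Suc)
          (simp add: algebra_simps power2_eq_square del: power_Suc)
  next
    case (Suc j)
    define d where "d = M - Suc j"
    have M: "M = d + j + 1" using Suc.prems by (simp add: d_def)
    \<comment> \<open>With M = d + j + 1 all subtractions disappear. \<open>A\<close> and
      \<open>B\<close> have the largest indices that occur, so every other reciprocal is a
      polynomial multiple of one of them and the step becomes a polynomial identity.\<close>
    define x y z s A B where "x = q ^ j" and "y = q ^ d" and "z = q ^ j\<^sup>2"
      and "s = (-1 :: 'a fps) ^ j" and "A = ?u (Suc d)" and "B = ?u (Suc M + Suc j)"
    note abbr = x_def y_def z_def s_def A_def B_def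
    have ud: "?u (M - Suc j) = (1 - y * q) * A"
      using u[of d] by (simp add: abbr d_def mult_ac)
    have uM: "?u (Suc M + j) = (1 - y * x * x * q * q * q) * B" "?u (M + Suc j) = ?u (Suc M + j)"
      using u[of "M + Suc j"] by (simp_all add: abbr M power_add mult_ac)
    have A: "?u (M - j) = A" "?u (Suc M - Suc j) = A"
      by (simp_all add: abbr M)
    have pow: "q ^ (Suc j)\<^sup>2 = z * x * x * q" "q ^ (2 * Suc M) = (y * x * q * q)\<^sup>2"
      "q ^ (Suc M + j\<^sup>2 + j) = y * x * q * q * z * x"
      "q ^ (Suc M + (Suc j)\<^sup>2 + Suc j) = y * x * q * q * (z * x * x * q) * x * q"
      unfolding M abbr by (simp_all add: power2_eq_square power_add power_mult[of q _ 2] mult_ac)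
    have sgn: "theta_sign (Suc j) = - (2 * s)" "(-1 :: 'a fps) ^ Suc j = - s"
      by (simp_all add: theta_sign_def abbr)
    have "(\<Sum>n\<le>Suc j. w' n - (1 - q ^ (2 * Suc M)) * w n) =
        - 2 * s * (y * x * q * q * z * x) * A * ((1 - y * x * x * q * q * q) * B) +
        (- (2 * s) * (z * x * x * q) * ((1 - y * q) * A) * ((1 - y * x * x * q * q * q) * B) -
         (1 - (y * x * q * q)\<^sup>2) * (- (2 * s) * (z * x * x * q) * A * B))"
      using Suc by (simp only: sum.atMost_Suc w_def w'_def sgn pow ud uM A s_def [symmetric]
        B_def [symmetric] Suc_leD)
    also have "\<dots> = - 2 * (- s) * (y * x * q * q * (z * x * x * q) * x * q) * ((1 - y * q) * A) * B"
      by (simp add: algebra_simps power2_eq_square)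
    finally show ?case
      by (simp only: sgn pow ud B_def)
  qed
  have "S M - (1 - q ^ (2 * Suc M)) * S (Suc M) =
      (\<Sum>n\<le>M. w' n - (1 - q ^ (2 * Suc M)) * w n) - (1 - q ^ (2 * Suc M)) * w (Suc M)"
    unfolding S_def w_def w'_def
    by (simp only: sum_subtractf sum_distrib_left [symmetric] sum.atMost_Suc[of _ M] distrib_left) simp
  \<comment> \<open>S(M+1) has one more term than S(M). It cancels the closed form at j = M, since
    the two exponents agree and u(2M+1) = (1 - q^(2M+2)) u(2M+2).\<close>
  also have "\<dots> = 0"
  proof -
    have "?u (Suc M + M) = (1 - q ^ (2 * Suc M)) * ?u (Suc M + Suc M)"
      using u[of "Suc M + M"] by (simp add: mult_2)
    moreover have "Suc M + M\<^sup>2 + M = (Suc M)\<^sup>2"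
      by (simp add: power2_eq_square)
    ultimately show ?thesis
      by (subst partial[OF order_refl], simp only: w_def theta_sign_def) (simp add: mult_ac)
  qed
  finally have "(1 - q ^ (2 * Suc M)) * S (Suc M) = S M" by simp
  also have "\<dots> = qrec (q\<^sup>2) M" using Suc.IH by (simp add: S_def)
  also have "\<dots> = (1 - q ^ (2 * Suc M)) * qrec (q\<^sup>2) (Suc M)"
    using qrec_eq_Suc[of "q\<^sup>2" M] q0 by (simp only: power_mult) (simp add: power2_eq_square)
  finally show ?case
    using one_minus_power_neq_0[OF q0, of "2 * Suc M"] unfolding S_def mult_cancel_left by simp
qed

text \<open>This is the finite triple product at z = -1, divided by (q^2;q^2)_(2m). The induction
  uses c S(M+1) = (1 - b)^2 S(M).\<close>

lemma finite_jacobi_triple: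
  fixes q :: "'a::field fps"
  assumes q0: "fps_nth q 0 = 0"
  shows "(\<Sum>n\<le>m. theta_sign n * q ^ n\<^sup>2 * qrec (q\<^sup>2) (m - n) * qrec (q\<^sup>2) (m + n)) =
         (qpoch q (q\<^sup>2) m)\<^sup>2 * qrec (q\<^sup>2) (2 * m)"
proof (induction m)
  case 0
  then show ?case by (simp add: theta_sign_def)
next
  case (Suc M)
  let ?u = "qrec (q\<^sup>2)"
  have u: "?u n = (1 - q ^ (2 * Suc n)) * ?u (Suc n)" for n
    using qrec_eq_Suc[of "q\<^sup>2" n] q0 by (simp only: power_mult) (simp add: power2_eq_square)
  define S where "S = (\<lambda>m. \<Sum>n\<le>m. theta_sign n * q ^ n\<^sup>2 * ?u (m - n) * ?u (m + n))"
  define w where "w = (\<lambda>n. theta_sign n * q ^ n\<^sup>2 * ?u (Suc M - n) * ?u (Suc M + n))"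
  define w' where "w' = (\<lambda>n. theta_sign n * q ^ n\<^sup>2 * ?u (M - n) * ?u (M + n))"
  \<comment> \<open>1 - b is the factor that (q;q^2)_M gains at M + 1, and c is the quotient of
    (q^2;q^2)_(2M+2) by (q^2;q^2)_(2M).\<close>
  define b where "b = q ^ (2 * M + 1)"
  define c where "c = (1 - b * b * q * q) * (1 - b * b)"
  \<comment> \<open>Half of the right side is an antidifference of the bilateral summand. It is
    antisymmetric under j -> -1 - j, so summing from -j to j doubles it.\<close>
  have partial: "(\<Sum>n\<le>j. (1 - b)\<^sup>2 * w' n - c * w n) =
      - 2 * b * (1 - b) * (-1) ^ j * q ^ j\<^sup>2 * (1 + q ^ (2 * j + 1)) * ?u (M - j) * ?u (Suc M + j)"
    if "j \<le> M" for j
    using that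
  proof (induction j)
    case 0
    have "?u M = (1 - b * q) * ?u (Suc M)" using u[of M] by (simp add: b_def mult_ac)
    then show ?case
      by (simp add: w_def w'_def theta_sign_def c_def)
          (simp add: algebra_simps power2_eq_square del: power_Suc)
  next
    case (Suc j)
    define d where "d = M - Suc j"
    have M: "M = d + j + 1" using Suc.prems by (simp add: d_def)
    define x y z s A B where "x = q ^ j" and "y = q ^ d" and "z = q ^ j\<^sup>2"
      and "s = (-1 :: 'a fps) ^ j" and "A = ?u (Suc d)" and "B = ?u (Suc M + Suc j)"
    note abbr = x_def y_def z_def s_def A_def B_def
    have ud: "?u (M - Suc j) = (1 - (y * q)\<^sup>2) * A"
      using u[of d] by (simp add: abbr d_def power2_eq_square power_add mult_2 mult_2_right mult_ac)
    have uM: "?u (Suc M + j) = (1 - (y * x * x * q * q * q)\<^sup>2) * B"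
      "?u (M + Suc j) = ?u (Suc M + j)"
      using u[of "M + Suc j"]
      by (simp_all add: abbr M power2_eq_square power4_eq_xxxx power_add power_mult[of q _ 2]
          power_mult[of q _ 4] mult_ac)
    have A: "?u (M - j) = A" "?u (Suc M - Suc j) = A"
      by (simp_all add: abbr M)
    have pow: "q ^ (Suc j)\<^sup>2 = z * x * x * q"
      "q ^ (2 * j + 1) = x * x * q" "q ^ (2 * Suc j + 1) = x * x * q * q * q"
      unfolding abbr by (simp_all add: power2_eq_square power_add power_mult[of q _ 2] mult_ac)
    have b: "b = (y * x * q)\<^sup>2 * q"
      unfolding M abbr b_def by (simp add: power2_eq_square power_add power_mult[of q _ 2] mult_ac)
    have sgn: "theta_sign (Suc j) = - (2 * s)" "(-1 :: 'a fps) ^ Suc j = - s"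
      by (simp_all add: theta_sign_def abbr)
    have "(\<Sum>n\<le>Suc j. (1 - b)\<^sup>2 * w' n - c * w n) =
        - 2 * b * (1 - b) * s * z * (1 + x * x * q) * A * ((1 - (y * x * x * q * q * q)\<^sup>2) * B) +
        ((1 - b)\<^sup>2 * (- (2 * s) * (z * x * x * q) * ((1 - (y * q)\<^sup>2) * A) *
            ((1 - (y * x * x * q * q * q)\<^sup>2) * B)) -
         c * (- (2 * s) * (z * x * x * q) * A * B))"
      using Suc by (simp only: sum.atMost_Suc w_def w'_def sgn pow ud uM A s_def [symmetric]
        z_def [symmetric] B_def [symmetric] Suc_leD)
    also have "\<dots> = - 2 * b * (1 - b) * (- s) * (z * x * x * q) * (1 + x * x * q * q * q) *
        ((1 - (y * q)\<^sup>2) * A) * B"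
      unfolding c_def b by (simp add: algebra_simps power2_eq_square)
    finally show ?case
      by (simp only: sgn pow ud B_def)
  qed
  have "(1 - b)\<^sup>2 * S M - c * S (Suc M) = (\<Sum>n\<le>M. (1 - b)\<^sup>2 * w' n - c * w n) - c * w (Suc M)"
    unfolding S_def w_def w'_def
    by (simp only: sum_subtractf sum_distrib_left [symmetric] sum.atMost_Suc[of _ M] distrib_left) simp
  \<comment> \<open>At j = M the factors (1 - b)(1 + b) and 1 - b^2 q^2 combine to \<open>c\<close>,
    which matches the extra term c w(M+1).\<close>
  also have "\<dots> = 0"
  proof -
    have "?u (Suc M + M) = (1 - b * b * q * q) * ?u (Suc M + Suc M)"
      using u[of "Suc M + M"] by (simp add: b_def power_add power_mult[of q _ 2] power_mult[of q _ 4]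
          power2_eq_square power4_eq_xxxx mult_ac)
    moreover have "q ^ (Suc M)\<^sup>2 = q ^ M\<^sup>2 * b"
      by (simp add: power2_eq_square power_add b_def power_mult[of q _ 2] mult_ac)
    then have "w (Suc M) = - (2 * (-1) ^ M) * (q ^ M\<^sup>2 * b) * ?u (Suc M + Suc M)"
      by (simp only: w_def theta_sign_def) simp
    ultimately show ?thesis
      by (subst partial[OF order_refl], simp only: b_def [symmetric] c_def)
        (simp add: algebra_simps power2_eq_square)
  qed
  finally have "c * S (Suc M) = (1 - b)\<^sup>2 * S M"
    by (simp only: right_minus_eq)
  also have "S M = (qpoch q (q\<^sup>2) M)\<^sup>2 * ?u (2 * M)"
    using Suc.IH by (simp add: S_def)
  also have "?u (2 * M) = c * ?u (2 * Suc M)"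
  proof -
    have "q ^ (2 * Suc (2 * M)) = b * b" "q ^ (2 * Suc (Suc (2 * M))) = b * b * q * q"
      unfolding b_def by (simp_all flip: power_add power_Suc power_Suc2 add: mult_2)
    moreover have "2 * Suc M = Suc (Suc (2 * M))" by simp
    ultimately show ?thesis
      using u[of "2 * M"] u[of "Suc (2 * M)"] unfolding c_def by (simp only: mult_ac)
  qed

  finally have "c * S (Suc M) = c * ((qpoch q (q\<^sup>2) M * (1 - b))\<^sup>2 * ?u (2 * Suc M))"
    by (simp only: power_mult_distrib mult_ac)
  moreover have "qpoch q (q\<^sup>2) (Suc M) = qpoch q (q\<^sup>2) M * (1 - b)"
    by (simp add: qpoch_Suc b_def power_mult)
  moreover have "fps_nth c 0 = 1"
    using q0 by (simp add: c_def b_def)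
  then have "c \<noteq> 0" by auto
  ultimately show ?case
    unfolding S_def mult_cancel_left by simp
qed

section \<open>Congruences modulo powers of the variable\<close>

text \<open>Each factor 1 - q^i with i > L is 1 modulo q^(L+1).\<close>

lemma power_dvd_qpoch_diff:
  fixes q :: "'a::comm_ring_1"
  assumes "L \<le> K"
  shows "q ^ Suc L dvd qpoch q q K - qpoch q q L"
  using assms
proof (induction rule: dec_induct)
  case (step K)
  have "q ^ Suc L dvd q ^ Suc K"
    using step.hyps by (intro le_imp_power_dvd) simp
  then have "q ^ Suc L dvd (qpoch q q K - qpoch q q L) - qpoch q q K * q ^ Suc K"
    by (rule dvd_diff[OF step.IH dvd_mult])
  also have "\<dots> = qpoch q q (Suc K) - qpoch q q L"
    by (simp add: qpoch_Suc algebra_simps)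
  finally show ?case .
qed simp

lemma power_dvd_qpoch_ratio:
  fixes q :: "'a::field fps"
  assumes "fps_nth q 0 = 0" "L \<le> K"
  shows "q ^ Suc L dvd qpoch q q K * qrec q L - 1" "q ^ Suc L dvd qpoch q q L * qrec q K - 1"
proof -
  have "qpoch q q K * qrec q L - 1 = (qpoch q q K - qpoch q q L) * qrec q L"
    by (simp only: left_diff_distrib qpoch_mult_qrec[OF assms(1)])
  then show "q ^ Suc L dvd qpoch q q K * qrec q L - 1"
    using power_dvd_qpoch_diff[OF assms(2), of q] by simp
  have "qpoch q q L * qrec q K - 1 = - ((qpoch q q K - qpoch q q L) * qrec q K)"
    by (simp only: left_diff_distrib qpoch_mult_qrec[OF assms(1)]) simp
  then show "q ^ Suc L dvd qpoch q q L * qrec q K - 1"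
    using power_dvd_qpoch_diff[OF assms(2), of q] by simp
qed

lemma dvd_mult_minus_1:
  fixes a b d :: "'a::comm_ring_1"
  assumes "d dvd a - 1" "d dvd b - 1"
  shows "d dvd a * b - 1"
proof -
  have "d dvd (a - 1) * b + (b - 1)"
    using assms by (intro dvd_add dvd_mult2)
  then show ?thesis by (simp add: algebra_simps)
qed

lemma fps_X_power_dvd_iff:
  fixes f :: "'a::field fps"
  shows "fps_X ^ n dvd f \<longleftrightarrow> (\<forall>k<n. fps_nth f k = 0)"
proof (cases "f = 0")
  case False
  have "fps_X ^ n dvd f \<longleftrightarrow> n \<le> subdegree f"
    using False by (simp add: fps_dvd_iff)
  also have "\<dots> \<longleftrightarrow> (\<forall>k<n. fps_nth f k = 0)"
    using False by (meson less_le_trans linorder_not_le nth_less_subdegree_zero nth_subdegree_nonzero)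
  finally show ?thesis .
qed simp

text \<open>Both terms are congruent to 1/(q;q)_L: each is \<open>u L\<close> times two ratios of
  Pochhammer symbols close to 1. The modulus is dictated by the ratios with index L - n; the missing
  factor X^n is later supplied by the theta exponent.\<close>

lemma theta_quotient_dvd:
  fixes L n :: nat
  defines "u \<equiv> qrec (fps_X :: 'a::field fps)" and "P \<equiv> qpoch fps_X (fps_X :: 'a fps)"
    and "v \<equiv> qrec (fps_X ^ 6 :: 'a fps)" and "Q \<equiv> qpoch (fps_X ^ 6) (fps_X ^ 6 :: 'a fps)"
  assumes "n \<le> L"
  shows "fps_X ^ Suc (L - n) dvd P L * u (L - n) * u (L + n) - v (L - n) * v (L + n) * Q (2 * L) * Q L * u L"
proof -
  let ?d = "fps_X ^ Suc (L - n) :: 'a fps"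
  have P: "?d dvd P L * u (L - n) - 1" "?d dvd P L * u (L + n) - 1"
  proof -
    show "?d dvd P L * u (L - n) - 1"
      unfolding P_def u_def by (rule power_dvd_qpoch_ratio) auto
    have "?d dvd fps_X ^ Suc L" by (rule le_imp_power_dvd) simp
    also have "\<dots> dvd P L * u (L + n) - 1"
      unfolding P_def u_def by (rule power_dvd_qpoch_ratio) auto
    finally show "?d dvd P L * u (L + n) - 1" .
  qed
  have Q: "?d dvd Q L * v (L - n) - 1" "?d dvd Q (2 * L) * v (L + n) - 1"
  proof -
    have "?d dvd (fps_X ^ 6) ^ Suc (L - n)"
      unfolding power_mult [symmetric] by (rule le_imp_power_dvd) simp
    also have "\<dots> dvd Q L * v (L - n) - 1"
      unfolding Q_def v_def by (rule power_dvd_qpoch_ratio) auto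
    finally show "?d dvd Q L * v (L - n) - 1" .
    have "?d dvd (fps_X ^ 6) ^ Suc (L + n)"
      unfolding power_mult [symmetric] by (rule le_imp_power_dvd) simp
    also have "\<dots> dvd Q (2 * L) * v (L + n) - 1"
      unfolding Q_def v_def by (rule power_dvd_qpoch_ratio) (use assms in auto)
    finally show "?d dvd Q (2 * L) * v (L + n) - 1" .
  qed
  have "P L * u (L - n) * u (L + n) - v (L - n) * v (L + n) * Q (2 * L) * Q L * u L =
      u L * ((P L * u (L - n)) * (P L * u (L + n)) - 1) -
      u L * ((Q L * v (L - n)) * (Q (2 * L) * v (L + n)) - 1)"
  proof -
    have "u L * ((P L * u (L - n)) * (P L * u (L + n))) = (P L * u L) * (P L * u (L - n) * u (L + n))"
      by (simp only: mult_ac)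
    also have "P L * u L = 1"
      unfolding P_def u_def by (rule qpoch_mult_qrec) simp
    finally show ?thesis by (simp add: right_diff_distrib mult_ac)
  qed
  then show ?thesis
    using dvd_mult_minus_1[OF P] dvd_mult_minus_1[OF Q] by (simp del: power_Suc)
qed

section \<open>Truncated sum and truncated product\<close>

definition partial_sum :: "nat \<Rightarrow> 'a::field fps" where
  "partial_sum L = (\<Sum>N\<le>L. \<Sum>m\<le>N.
     fps_X ^ N\<^sup>2 * fps_X ^ m\<^sup>2 * qrec fps_X (N - m) * qrec (fps_X\<^sup>2) m)"

definition partial_prod :: "nat \<Rightarrow> 'a::field fps" where
  "partial_prod L = (qpoch (fps_X ^ 3) (fps_X ^ 6) L)\<^sup>2 * qpoch (fps_X ^ 6) (fps_X ^ 6) L * qrec fps_X L"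

text \<open>Gauss' pair carries one factor q^(n^2) and each use of Bailey's lemma adds another,
  whence 3 n^2.\<close>

lemma double_bailey:
  "(\<Sum>N\<le>L. fps_X ^ N\<^sup>2 * qrec fps_X (L - N) *
      (\<Sum>m\<le>N. fps_X ^ m\<^sup>2 * qrec fps_X (N - m) * qrec (fps_X\<^sup>2) m)) =
   (\<Sum>n\<le>L. theta_sign n * fps_X ^ (3 * n\<^sup>2) * qrec fps_X (L - n) * qrec (fps_X :: 'a::field fps) (L + n))"
proof -
  let ?X = "fps_X :: 'a fps"
  have X0: "fps_nth ?X 0 = 0" by simp
  have "(\<Sum>m\<le>N. ?X ^ m\<^sup>2 * qrec ?X (N - m) * qrec (?X\<^sup>2) m) =
      (\<Sum>n\<le>N. ?X ^ n\<^sup>2 * (theta_sign n * ?X ^ n\<^sup>2) * qrec ?X (N - n) * qrec ?X (N + n))" for N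
    unfolding gauss_bailey_pair[OF X0, symmetric] by (rule bailey_lemma[OF X0])
  then have "(\<Sum>N\<le>L. ?X ^ N\<^sup>2 * qrec ?X (L - N) *
      (\<Sum>m\<le>N. ?X ^ m\<^sup>2 * qrec ?X (N - m) * qrec (?X\<^sup>2) m)) =
      (\<Sum>n\<le>L. ?X ^ n\<^sup>2 * (?X ^ n\<^sup>2 * (theta_sign n * ?X ^ n\<^sup>2)) * qrec ?X (L - n) * qrec ?X (L + n))"
    by (simp only: bailey_lemma[OF X0])
  also have "\<dots> = (\<Sum>n\<le>L. theta_sign n * ?X ^ (3 * n\<^sup>2) * qrec ?X (L - n) * qrec ?X (L + n))"
  proof (intro sum.cong refl)
    fix n
    have "?X ^ (3 * n\<^sup>2) = ?X ^ n\<^sup>2 * (?X ^ n\<^sup>2 * ?X ^ n\<^sup>2)"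
      by (simp flip: power_add)
    then show "?X ^ n\<^sup>2 * (?X ^ n\<^sup>2 * (theta_sign n * ?X ^ n\<^sup>2)) * qrec ?X (L - n) * qrec ?X (L + n) =
        theta_sign n * ?X ^ (3 * n\<^sup>2) * qrec ?X (L - n) * qrec ?X (L + n)"
      by (simp only: mult_ac)
  qed
  finally show ?thesis .
qed

text \<open>Both sides are compared with (q;q)_L times the theta sum \<open>A\<close> of
  \<open>double_bailey\<close>.\<close>

lemma partial_sum_cong_partial_prod:
  "fps_X ^ Suc L dvd partial_sum L - (partial_prod L :: 'a::field fps)"
proof -
  let ?X = "fps_X :: 'a fps"
  let ?u = "qrec ?X" and ?P = "qpoch ?X ?X" and ?v = "qrec (?X ^ 6)" and ?Q = "qpoch (?X ^ 6) (?X ^ 6)"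
  let ?d = "?X ^ Suc L"
  define A where "A = (\<Sum>n\<le>L. theta_sign n * ?X ^ (3 * n\<^sup>2) * ?u (L - n) * ?u (L + n))"
  have "?d dvd ?P L * A - partial_sum L"
  proof -
    define B where "B = (\<lambda>N. \<Sum>m\<le>N. ?X ^ m\<^sup>2 * ?u (N - m) * qrec (?X\<^sup>2) m)"
    have "?P L * A - partial_sum L =
        (\<Sum>N\<le>L. ?X ^ N\<^sup>2 * (?P L * ?u (L - N) - 1) * B N)"
      unfolding A_def double_bailey [symmetric] partial_sum_def B_def [symmetric]
      by (simp add: B_def sum_distrib_left sum_subtractf algebra_simps)
    also have "?d dvd \<dots>"
    proof (rule dvd_sum, rule dvd_mult2)
      fix N assume N: "N \<in> {..L}"
      \<comment> \<open>The ratio (q;q)_L / (q;q)_(L-N) is 1 only modulo X^(L-N+1); the loss of N is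
        covered by X^(N^2), as N^2 is at least N.\<close>
      have "?d dvd ?X ^ (N\<^sup>2 + Suc (L - N))"
        using self_le_power[of N 2] N by (intro le_imp_power_dvd) (cases N; simp)
      also have "\<dots> dvd ?X ^ N\<^sup>2 * (?P L * ?u (L - N) - 1)"
        unfolding power_add by (intro mult_dvd_mono dvd_refl power_dvd_qpoch_ratio) auto
      finally show "?d dvd ?X ^ N\<^sup>2 * (?P L * ?u (L - N) - 1)" .
    qed
    finally show ?thesis .
  qed
  moreover have "?d dvd ?P L * A - partial_prod L"
  proof -
    have "(\<Sum>n\<le>L. theta_sign n * (?X ^ 3) ^ n\<^sup>2 * qrec ((?X ^ 3)\<^sup>2) (L - n) * qrec ((?X ^ 3)\<^sup>2) (L + n)) =
         (qpoch (?X ^ 3) ((?X ^ 3)\<^sup>2) L)\<^sup>2 * qrec ((?X ^ 3)\<^sup>2) (2 * L)"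
      by (rule finite_jacobi_triple) simp
    then have theta: "(\<Sum>n\<le>L. theta_sign n * ?X ^ (3 * n\<^sup>2) * ?v (L - n) * ?v (L + n)) =
         (qpoch (?X ^ 3) (?X ^ 6) L)\<^sup>2 * ?v (2 * L)"
      by (simp flip: power_mult)
    \<comment> \<open>Inserting (q^6;q^6)_(2L) times its reciprocal exposes the right side of the
      triple product, which is then replaced by its sum so that both sides compare term by
      term.\<close>
    have "partial_prod L = (qpoch (?X ^ 3) (?X ^ 6) L)\<^sup>2 * (?Q (2 * L) * ?v (2 * L)) * ?Q L * ?u L"
      by (subst qpoch_mult_qrec) (simp_all add: partial_prod_def)
    also have "\<dots> = (qpoch (?X ^ 3) (?X ^ 6) L)\<^sup>2 * ?v (2 * L) * (?Q (2 * L) * ?Q L * ?u L)"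
      by (simp only: mult_ac)
    also have "\<dots> = (\<Sum>n\<le>L. theta_sign n * ?X ^ (3 * n\<^sup>2) * ?v (L - n) * ?v (L + n)) * (?Q (2 * L) * ?Q L * ?u L)"
      by (simp only: theta)
    finally have "?P L * A - partial_prod L = (\<Sum>n\<le>L. ?X ^ (3 * n\<^sup>2) *
        (?P L * ?u (L - n) * ?u (L + n) - ?v (L - n) * ?v (L + n) * ?Q (2 * L) * ?Q L * ?u L) * theta_sign n)"
      unfolding A_def by (simp add: sum_distrib_left sum_distrib_right sum_subtractf algebra_simps)
    also have "?d dvd \<dots>"
    proof (rule dvd_sum, rule dvd_mult2)
      fix n assume n: "n \<in> {..L}"
      have "?d dvd ?X ^ (3 * n\<^sup>2 + Suc (L - n))"
        using self_le_power[of n 2] n by (intro le_imp_power_dvd) (cases n; simp)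
      also have "\<dots> dvd ?X ^ (3 * n\<^sup>2) *
          (?P L * ?u (L - n) * ?u (L + n) - ?v (L - n) * ?v (L + n) * ?Q (2 * L) * ?Q L * ?u L)"
        unfolding power_add by (intro mult_dvd_mono dvd_refl theta_quotient_dvd) (use n in auto)
      finally show "?d dvd ?X ^ (3 * n\<^sup>2) *
          (?P L * ?u (L - n) * ?u (L + n) - ?v (L - n) * ?v (L + n) * ?Q (2 * L) * ?Q L * ?u L)" .
    qed
    finally show ?thesis .
  qed
  ultimately have "?d dvd (?P L * A - partial_prod L) - (?P L * A - partial_sum L)"
    by (metis dvd_diff)
  then show ?thesis by simp
qed

lemma partial_prod_conv_prod:
  "partial_prod L = (\<Prod>n<L. (1 - fps_X ^ (6 * Suc n - 3))\<^sup>2 * (1 - fps_X ^ (6 * Suc n)) /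
     (1 - (fps_X :: 'a::field fps) ^ Suc n))"
proof (induction L)
  case 0
  then show ?case by (simp add: partial_prod_def)
next
  case (Suc L)
  let ?X = "fps_X :: 'a fps"
  have nz: "fps_nth (1 - ?X ^ Suc L) 0 \<noteq> 0" by simp
  have div: "f / (1 - ?X ^ Suc L) = f * inverse (1 - ?X ^ Suc L)" for f
    by (rule fps_divide_unit[OF nz])
  have u: "qrec ?X (Suc L) = qrec ?X L * inverse (1 - ?X ^ Suc L)"
    by (simp add: qrec_def qpoch_Suc fps_inverse_mult)
  have "6 * Suc L - 3 = 3 + 6 * L" by simp
  then have pow: "?X ^ (6 * Suc L - 3) = ?X ^ 3 * (?X ^ 6) ^ L" "?X ^ (6 * Suc L) = ?X ^ 6 * (?X ^ 6) ^ L"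
    by (simp_all only: power_add power_mult power_Suc)
  show ?case
    unfolding prod.lessThan_Suc Suc.IH [symmetric] div pow
    by (simp only: partial_prod_def qpoch_Suc u power_mult_distrib mult_ac)
qed

lemma partial_sum_conv_sum:
  "partial_sum L = (\<Sum>(m, r) | m + r \<le> L. fps_X ^ (2 * m\<^sup>2 + 2 * m * r + r\<^sup>2) /
     (qpoch (fps_X\<^sup>2) (fps_X\<^sup>2) m * qpoch fps_X (fps_X :: 'a::field fps) r))"
proof -
  let ?X = "fps_X :: 'a fps"
  have "partial_sum L = (\<Sum>(N, m) \<in> (SIGMA N:{..L}. {..N}).
      ?X ^ N\<^sup>2 * ?X ^ m\<^sup>2 * qrec ?X (N - m) * qrec (?X\<^sup>2) m)"
    unfolding partial_sum_def by (rule sum.Sigma) auto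
  also have "\<dots> = (\<Sum>(m, r) | m + r \<le> L.
      ?X ^ (m + r)\<^sup>2 * ?X ^ m\<^sup>2 * qrec ?X r * qrec (?X\<^sup>2) m)"
    by (rule sum.reindex_bij_witness[of _ "\<lambda>(m, r). (m + r, m)" "\<lambda>(N, m). (m, N - m)"]) auto
  also have "\<dots> = (\<Sum>(m, r) | m + r \<le> L. ?X ^ (2 * m\<^sup>2 + 2 * m * r + r\<^sup>2) /
     (qpoch (?X\<^sup>2) (?X\<^sup>2) m * qpoch ?X ?X r))"
  proof (intro sum.cong refl, clarify)
    fix m r :: nat
    have "2 * m\<^sup>2 + 2 * m * r + r\<^sup>2 = (m + r)\<^sup>2 + m\<^sup>2"
      by (simp add: power2_eq_square algebra_simps)
    then have "?X ^ (2 * m\<^sup>2 + 2 * m * r + r\<^sup>2) = ?X ^ (m + r)\<^sup>2 * ?X ^ m\<^sup>2"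
      by (simp only: power_add)
    then show "?X ^ (m + r)\<^sup>2 * ?X ^ m\<^sup>2 * qrec ?X r * qrec (?X\<^sup>2) m =
        ?X ^ (2 * m\<^sup>2 + 2 * m * r + r\<^sup>2) / (qpoch (?X\<^sup>2) (?X\<^sup>2) m * qpoch ?X ?X r)"
      by (subst fps_divide_unit)
        (simp_all add: fps_nth_0_qpoch fps_inverse_mult qrec_def mult_ac)
  qed
  finally show ?thesis .
qed

section \<open>Passage to the limit\<close>

theorem theorem5:
  fixes q :: "'a::field fps"
  assumes "q = fps_X"
  shows "(\<lambda>(m, r). q ^ (2 * m\<^sup>2 + 2 * m * r + r\<^sup>2) / (qpoch (q\<^sup>2) (q\<^sup>2) m * qpoch q q r))
           summable_on UNIV \<and>
         convergent_prod (\<lambda>n. (1 - q ^ (6 * Suc n - 3))\<^sup>2 * (1 - q ^ (6 * Suc n)) / (1 - q ^ Suc n)) \<and>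
         (\<Sum>\<^sub>\<infinity>(m, r)\<in>UNIV. q ^ (2 * m\<^sup>2 + 2 * m * r + r\<^sup>2) / (qpoch (q\<^sup>2) (q\<^sup>2) m * qpoch q q r)) =
         (\<Prod>n. (1 - q ^ (6 * Suc n - 3))\<^sup>2 * (1 - q ^ (6 * Suc n)) / (1 - q ^ Suc n))"
proof -
  define t where "t = (\<lambda>(m, r). q ^ (2 * m\<^sup>2 + 2 * m * r + r\<^sup>2) / (qpoch (q\<^sup>2) (q\<^sup>2) m * qpoch q q r))"
  define f where "f = (\<lambda>n. (1 - q ^ (6 * Suc n - 3))\<^sup>2 * (1 - q ^ (6 * Suc n)) / (1 - q ^ Suc n))"
  \<comment> \<open>The coefficient at \<open>k\<close> no longer changes from
    \<open>partial_sum k\<close> on, so this diagonal choice is the limit.\<close>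
  define S where "S = Abs_fps (\<lambda>k. fps_nth (partial_sum k :: 'a fps) k)"
  have T: "partial_sum k = sum t {(m, r). m + r \<le> k}" for k
    unfolding t_def assms partial_sum_conv_sum by (simp add: case_prod_unfold)
  have fin: "finite {(m, r). m + r \<le> (k :: nat)}" for k
    by (rule finite_subset[of _ "{..k} \<times> {..k}"]) auto
  have t_nth: "fps_nth (t x) k = 0" if "x \<notin> {(m, r). m + r \<le> k}" for x k
  proof -
    obtain m r where x: "x = (m, r)" by (cases x)
    have "fps_nth (qpoch (q\<^sup>2) (q\<^sup>2) m * qpoch q q r) 0 \<noteq> 0"
      by (simp add: assms fps_nth_0_qpoch)
    then have "q ^ (2 * m\<^sup>2 + 2 * m * r + r\<^sup>2) dvd t x"
      by (simp add: x t_def fps_divide_unit)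
    moreover have "Suc k \<le> 2 * m\<^sup>2 + 2 * m * r + r\<^sup>2"
    proof -
      have "Suc k \<le> m + r" using that x by simp
      also have "\<dots> \<le> (m + r)\<^sup>2" by (rule self_le_power) (use that x in auto)
      also have "\<dots> \<le> 2 * m\<^sup>2 + 2 * m * r + r\<^sup>2" by (simp add: power2_sum)
      finally show ?thesis .
    qed
    ultimately have "fps_X ^ Suc k dvd t x"
      unfolding assms by (meson dvd_trans le_imp_power_dvd)
    then show ?thesis unfolding fps_X_power_dvd_iff by blast
  qed
  \<comment> \<open>Convergence of power series means that each coefficient is eventually constant;
    any finite index set containing the triangle m + r \<le> k already gives the final coefficient
    at \<open>k\<close>.\<close>
  have sum_nth: "fps_nth (sum t F) k = fps_nth S k"
    if "finite F" "{(m, r). m + r \<le> k} \<subseteq> F" for F k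
  proof -
    have "fps_nth (sum t F) k = (\<Sum>x\<in>F. fps_nth (t x) k)"
      by (rule fps_sum_nth)
    also have "\<dots> = (\<Sum>x | x \<in> {(m, r). m + r \<le> k}. fps_nth (t x) k)"
      using that t_nth by (intro sum.mono_neutral_right) auto
    also have "\<dots> = fps_nth S k"
      by (simp add: S_def T fps_sum_nth)
    finally show ?thesis .
  qed
  have "(t has_sum S) UNIV"
    unfolding has_sum_def
  proof (rule tendsto_fpsI)
    fix k
    show "\<forall>\<^sub>F F in finite_subsets_at_top UNIV. fps_nth (sum t F) k = fps_nth S k"
      unfolding eventually_finite_subsets_at_top
      by (rule exI[of _ "{(m, r). m + r \<le> k}"]) (use fin sum_nth in auto)
  qed
  moreover have "raw_has_prod f 0 S"
    unfolding raw_has_prod_def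
  proof
    show "(\<lambda>n. \<Prod>i\<le>n. f (i + 0)) \<longlonglongrightarrow> S"
    proof (rule tendsto_fpsI)
      fix k
      have "fps_nth (\<Prod>i\<le>L. f (i + 0)) k = fps_nth S k" if "L \<ge> k" for L
      proof -
        \<comment> \<open>The product over i \<le> L has L + 1 factors, hence the index
          \<open>Suc L\<close>.\<close>
        have "(\<Prod>i\<le>L. f (i + 0)) = partial_prod (Suc L)"
          by (simp only: partial_prod_conv_prod f_def assms lessThan_Suc_atMost add_0_right)
        also have "fps_nth \<dots> k = fps_nth (partial_sum (Suc L)) k"
          using partial_sum_cong_partial_prod[of "Suc L", where 'a = 'a] that
          unfolding fps_X_power_dvd_iff by simp
        also have "\<dots> = fps_nth S k"
          unfolding T by (rule sum_nth[OF fin]) (use that in auto)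
        finally show ?thesis .
      qed
      then show "\<forall>\<^sub>F L in sequentially. fps_nth (\<Prod>i\<le>L. f (i + 0)) k = fps_nth S k"
        by (rule eventually_sequentiallyI)
    qed
    \<comment> \<open>Convergence of an infinite product includes a nonzero limit, which the
      constant term guarantees.\<close>
    have "fps_nth S 0 = 1"
      by (simp add: S_def partial_sum_def)
    then show "S \<noteq> 0" by auto
  qed
  then have "f has_prod S" "convergent_prod f"
    unfolding has_prod_def convergent_prod_def by blast+
  ultimately have "t summable_on UNIV" "convergent_prod f" "infsum t UNIV = prodinf f"
    by (auto simp: has_sum_iff has_prod_unique)
  then show ?thesis
    unfolding t_def f_def by blast
qed

end
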